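(* Let $G$ be a group with identity element $e$ and let $R=\oplus_{g\in G}R_g$ be a $G$-graded ring. If $R$ is $G$-controlled, then the following four assertions are equivalent: (i) $R$ is graded simple; (ii) $R$ is simple; (iii) $R$ is strongly $G$-graded; (iv) the $G$-gradation on $R$ is left (and right) non-degenerate.
   Context: Rings are associative and unital. For subsets $X,Y$ of a ring, $XY$ denotes the set of all finite sums of elements $xy$ with $x\in X$, $y\in Y$. A ring $R$ is $G$-graded if there are additive subgroups $R_g$ ($g\in G$) of $R$ with $R=\oplus_{g\in G}R_g$ and $R_gR_h\subseteq R_{gh}$ for all $g,h\in G$; it is strongly $G$-graded if moreover $R_gR_h=R_{gh}$ for all $g,h\in G$. Then $R_e$ is a subring of $R$ with $1_R\in R_e$, and each $R_g$ is an $R_e$-bimodule by multiplication in $R$. For $H\subseteq G$ put $R_H=\oplus_{h\in H}R_h$, with $R_\varnothing=\{0\}$; it is an $R_e$-bimodule. The $G$-graded ring $R$ is called $G$-controlled if, for the given gradation: (1) the map $H\mapsto R_H=\oplus_{h\in H}R_h$ from the power set of $G$ to the set of all $R_e$-bimodules contained in $R$ (with scalar multiplication coming from the multiplication of $R$) is a bijection; and (2) for $S,T\subseteq G$, $R_S\cong R_T$ as $R_e$-bimodules if and only if $S=T$. Ideals are two-sided. An ideal $I$ of $R$ is graded if $I=\oplus_{g\in G}(I\cap R_g)$. $R$ is graded simple if $R$ and $\{0\}$ are its only graded ideals. The $G$-gradation is left non-degenerate if $R_{g^{-1}}x\neq\{0\}$ for every $g\in G$ and every non-zero $x\in R_g$,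 and right non-degenerate if $xR_{g^{-1}}\neq\{0\}$ for every $g\in G$ and every non-zero $x\in R_g$; assertion (iv) means that the gradation is both left and right non-degenerate. *)

theory Defs
  imports "HOL-Algebra.Algebra"
begin

section \<open>Products of subsets and internal direct sums\<close>

text \<open>\<open>sum_prod R U V\<close> is \<open>UV\<close>, the set of all finite sums of products \<open>xy\<close> with
  \<open>x \<in> U\<close>, \<open>y \<in> V\<close>; it contains the empty sum.\<close>

definition sum_prod :: "('a, 'b) ring_scheme \<Rightarrow> 'a set \<Rightarrow> 'a set \<Rightarrow> 'a set" where
  "sum_prod R U V =
     {(\<Oplus>\<^bsub>R\<^esub>i\<in>{..<n}. x i \<otimes>\<^bsub>R\<^esub> y i) | (n::nat) x y.
        (\<forall>i<n. x i \<in> U) \<and> (\<forall>i<n. y i \<in> V)}"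

definition family_sum :: "('a, 'b) ring_scheme \<Rightarrow> 'i set \<Rightarrow> ('i \<Rightarrow> 'a set) \<Rightarrow> 'a set" where
  "family_sum R I A =
     {(\<Oplus>\<^bsub>R\<^esub>i\<in>F. x i) | F x. finite F \<and> F \<subseteq> I \<and> x \<in> (\<Pi> i\<in>F. A i)}"

text \<open>Meant for families of additive subgroups: \<open>M\<close> is the sum of the \<open>A i\<close>, \<open>i \<in> I\<close>, and this
  sum is direct.\<close>

definition internal_direct_sum ::
  "('a, 'b) ring_scheme \<Rightarrow> 'i set \<Rightarrow> ('i \<Rightarrow> 'a set) \<Rightarrow> 'a set \<Rightarrow> bool" where
  "internal_direct_sum R I A M \<longleftrightarrow>
     M = family_sum R I A \<and>
     (\<forall>F x. finite F \<longrightarrow> F \<subseteq> I \<longrightarrow> x \<in> (\<Pi> i\<in>F. A i) \<longrightarrow> (\<Oplus>\<^bsub>R\<^esub>i\<in>F. x i) = \<zero>\<^bsub>R\<^esub> \<longrightarrow>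
        (\<forall>i\<in>F. x i = \<zero>\<^bsub>R\<^esub>))"


section \<open>Graded rings\<close>

locale graded_ring = G: group G + R: ring R
  for G :: "('g, 'c) monoid_scheme" (structure) and R :: "('r, 'd) ring_scheme" (structure) +
  fixes A :: "'g \<Rightarrow> 'r set"
  assumes component_subgroup: "g \<in> carrier G \<Longrightarrow> additive_subgroup (A g) R"
    and direct_sum: "internal_direct_sum R (carrier G) A (carrier R)"
    and component_mult:
      "\<lbrakk>g \<in> carrier G; h \<in> carrier G\<rbrakk> \<Longrightarrow> sum_prod R (A g) (A h) \<subseteq> A (g \<otimes>\<^bsub>G\<^esub> h)"

definition strongly_graded ::
  "('g, 'c) monoid_scheme \<Rightarrow> ('r, 'd) ring_scheme \<Rightarrow> ('g \<Rightarrow> 'r set) \<Rightarrow> bool" where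
  "strongly_graded G R A \<longleftrightarrow> graded_ring G R A \<and>
     (\<forall>g\<in>carrier G. \<forall>h\<in>carrier G. sum_prod R (A g) (A h) = A (g \<otimes>\<^bsub>G\<^esub> h))"


section \<open>Bimodules contained in a ring, and controlled gradations\<close>

text \<open>Unitality of the scalar multiplication is automatic when \<open>S\<close> is a subring of \<open>R\<close>
  containing \<open>\<one>\<close>.\<close>

definition sub_bimodule :: "('a, 'b) ring_scheme \<Rightarrow> 'a set \<Rightarrow> 'a set \<Rightarrow> bool" where
  "sub_bimodule R S M \<longleftrightarrow> additive_subgroup M R \<and>
     (\<forall>s\<in>S. \<forall>m\<in>M. s \<otimes>\<^bsub>R\<^esub> m \<in> M \<and> m \<otimes>\<^bsub>R\<^esub> s \<in> M)"

definition bimodule_iso :: "('a, 'b) ring_scheme \<Rightarrow> 'a set \<Rightarrow> 'a set \<Rightarrow> 'a set \<Rightarrow> bool" where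
  "bimodule_iso R S M N \<longleftrightarrow> (\<exists>f. bij_betw f M N \<and>
     (\<forall>m\<in>M. \<forall>m'\<in>M. f (m \<oplus>\<^bsub>R\<^esub> m') = f m \<oplus>\<^bsub>R\<^esub> f m') \<and>
     (\<forall>s\<in>S. \<forall>m\<in>M. f (s \<otimes>\<^bsub>R\<^esub> m) = s \<otimes>\<^bsub>R\<^esub> f m \<and> f (m \<otimes>\<^bsub>R\<^esub> s) = f m \<otimes>\<^bsub>R\<^esub> s))"

definition controlled ::
  "('g, 'c) monoid_scheme \<Rightarrow> ('r, 'd) ring_scheme \<Rightarrow> ('g \<Rightarrow> 'r set) \<Rightarrow> bool" where
  "controlled G R A \<longleftrightarrow> graded_ring G R A \<and>
     bij_betw (\<lambda>H. family_sum R H A) (Pow (carrier G)) {M. sub_bimodule R (A \<one>\<^bsub>G\<^esub>) M} \<and>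
     (\<forall>S T. S \<subseteq> carrier G \<longrightarrow> T \<subseteq> carrier G \<longrightarrow>
        (bimodule_iso R (A \<one>\<^bsub>G\<^esub>) (family_sum R S A) (family_sum R T A) \<longleftrightarrow> S = T))"


section \<open>Simplicity and non-degeneracy\<close>

definition graded_ideal ::
  "('g, 'c) monoid_scheme \<Rightarrow> ('r, 'd) ring_scheme \<Rightarrow> ('g \<Rightarrow> 'r set) \<Rightarrow> 'r set \<Rightarrow> bool" where
  "graded_ideal G R A I \<longleftrightarrow> ideal I R \<and>
     internal_direct_sum R (carrier G) (\<lambda>g. I \<inter> A g) I"

text \<open>The zero ring counts as simple and as graded simple under the next two definitions; it is
  never \<open>controlled\<close>, because the power set of \<open>carrier G\<close> has at least two elements.\<close>

definition graded_simple ::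
  "('g, 'c) monoid_scheme \<Rightarrow> ('r, 'd) ring_scheme \<Rightarrow> ('g \<Rightarrow> 'r set) \<Rightarrow> bool" where
  "graded_simple G R A \<longleftrightarrow> (\<forall>I. graded_ideal G R A I \<longrightarrow> I = carrier R \<or> I = {\<zero>\<^bsub>R\<^esub>})"

definition simple_ring :: "('r, 'd) ring_scheme \<Rightarrow> bool" where
  "simple_ring R \<longleftrightarrow> ring R \<and> (\<forall>I. ideal I R \<longrightarrow> I = carrier R \<or> I = {\<zero>\<^bsub>R\<^esub>})"

definition left_nondegenerate ::
  "('g, 'c) monoid_scheme \<Rightarrow> ('r, 'd) ring_scheme \<Rightarrow> ('g \<Rightarrow> 'r set) \<Rightarrow> bool" where
  "left_nondegenerate G R A \<longleftrightarrow>
     (\<forall>g\<in>carrier G. \<forall>x\<in>A g - {\<zero>\<^bsub>R\<^esub>}. sum_prod R (A (inv\<^bsub>G\<^esub> g)) {x} \<noteq> {\<zero>\<^bsub>R\<^esub>})"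

definition right_nondegenerate ::
  "('g, 'c) monoid_scheme \<Rightarrow> ('r, 'd) ring_scheme \<Rightarrow> ('g \<Rightarrow> 'r set) \<Rightarrow> bool" where
  "right_nondegenerate G R A \<longleftrightarrow>
     (\<forall>g\<in>carrier G. \<forall>x\<in>A g - {\<zero>\<^bsub>R\<^esub>}. sum_prod R {x} (A (inv\<^bsub>G\<^esub> g)) \<noteq> {\<zero>\<^bsub>R\<^esub>})"

end

theory Submission
  imports Defs
begin

text \<open>
  For a controlled gradation every component \<open>R\<^sub>g\<close> is a non-zero simple \<open>R\<^sub>e\<close>-bimodule, so the
  product \<open>R\<^sub>g R\<^sub>h\<close> is either \<open>0\<close> or all of \<open>R\<^bsub>gh\<^esub>\<close>. Everything can then be read off from the relation
  ``\<open>R\<^sub>g R\<^sub>h \<noteq> 0\<close>'' on \<open>G\<close>, called \<open>nonvanishing\<close> below. Associativity of \<open>R\<close> says that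
  \<open>R\<^sub>a R\<^sub>b \<noteq> 0\<close> and \<open>R\<^bsub>ab\<^esub> R\<^sub>c \<noteq> 0\<close> hold together exactly when \<open>R\<^sub>b R\<^sub>c \<noteq> 0\<close> and \<open>R\<^sub>a R\<^bsub>bc\<^esub> \<noteq> 0\<close> do, both
  conditions meaning \<open>R\<^sub>a R\<^sub>b R\<^sub>c \<noteq> 0\<close>; the unit gives \<open>R\<^sub>e R\<^sub>g \<noteq> 0 \<noteq> R\<^sub>g R\<^sub>e\<close>. With these rules the
  relation is total as soon as \<open>R\<^sub>g R\<^bsub>g\<^sup>-\<^sup>1\<^esub> \<noteq> 0\<close> for all \<open>g\<close>, and totality is strong gradedness.

  Since every ideal is an \<open>R\<^sub>e\<close>-bimodule, it has the form \<open>R\<^sub>H\<close> and is therefore graded, so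
  graded simplicity and simplicity agree. Non-degeneracy says \<open>R\<^sub>g R\<^bsub>g\<^sup>-\<^sup>1\<^esub> \<noteq> 0\<close> one element at a
  time. Strong gradedness gives simplicity, because a non-zero ideal contains some \<open>R\<^sub>h\<close>, hence
  \<open>R\<^sub>h R\<^bsub>h\<^sup>-\<^sup>1\<^esub> = R\<^sub>e\<close>, hence \<open>1\<close>.

  The implication with content is from graded simplicity to strong gradedness. The ideal generated by
  \<open>R\<^sub>g\<close> is \<open>R\<^sub>H\<close>, where \<open>H\<close> consists of the \<open>agb\<close> with \<open>R\<^sub>a R\<^sub>g R\<^sub>b \<noteq> 0\<close>. Graded simplicity puts
  \<open>e\<close> into \<open>H\<close>, so \<open>R\<^sub>a R\<^sub>g R\<^sub>b = R\<^sub>e\<close> for some \<open>a\<close> and \<open>b\<close> with \<open>agb = e\<close>. Then \<open>R\<^sub>g R\<^sub>b = R\<^bsub>a\<^sup>-\<^sup>1\<^esub>\<close>, and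
  \<open>R\<^bsub>a\<^sup>-\<^sup>1\<^esub> R\<^sub>a \<noteq> 0\<close> because its mirror image \<open>R\<^sub>a R\<^bsub>a\<^sup>-\<^sup>1\<^esub>\<close> is non-zero; thus \<open>R\<^sub>g R\<^sub>b R\<^sub>a \<noteq> 0\<close>, and
  \<open>ba = g\<^sup>-\<^sup>1\<close> gives \<open>R\<^sub>g R\<^bsub>g\<^sup>-\<^sup>1\<^esub> \<noteq> 0\<close>.
\<close>

section \<open>Finite sums of products and sums of families\<close>

context ring
begin

lemma sum_prod_zero: "\<zero> \<in> sum_prod R U V"
proof -
  have "\<zero> = (\<Oplus>i\<in>{..<0::nat}. undefined i \<otimes> undefined i)" by simp
  then show ?thesis
    unfolding sum_prod_def by blast
qed

lemma sum_prod_add_product: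
  assumes "U \<subseteq> carrier R" "V \<subseteq> carrier R" "s \<in> sum_prod R U V" "u \<in> U" "v \<in> V"
  shows "s \<oplus> u \<otimes> v \<in> sum_prod R U V"
proof -
  obtain n :: nat and x y where s: "s = (\<Oplus>i\<in>{..<n}. x i \<otimes> y i)"
    and xy: "\<forall>i<n. x i \<in> U" "\<forall>i<n. y i \<in> V"
    using assms(3) unfolding sum_prod_def by blast
  let ?x = "x(n := u)" and ?y = "y(n := v)"
  have "(\<Oplus>i\<in>{..<n}. ?x i \<otimes> ?y i) = s"
    unfolding s by (rule add.finprod_cong') (use xy assms in \<open>auto intro!: m_closed\<close>)
  moreover have "(\<Oplus>i\<in>{..<Suc n}. ?x i \<otimes> ?y i) = ?x n \<otimes> ?y n \<oplus> (\<Oplus>i\<in>{..<n}. ?x i \<otimes> ?y i)"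
    unfolding lessThan_Suc
    by (rule finsum_insert) (use xy assms in \<open>auto intro!: m_closed\<close>)
  moreover have "s \<in> carrier R"
    unfolding s by (rule finsum_closed) (use xy assms in \<open>auto intro!: m_closed\<close>)
  ultimately have "s \<oplus> u \<otimes> v = (\<Oplus>i\<in>{..<Suc n}. ?x i \<otimes> ?y i)"
    using assms by (simp add: a_comm subset_iff)
  moreover have "\<forall>i<Suc n. ?x i \<in> U" "\<forall>i<Suc n. ?y i \<in> V"
    using xy assms by auto
  ultimately show ?thesis
    unfolding sum_prod_def by blast
qed

lemma sum_prod_product:
  assumes "U \<subseteq> carrier R" "V \<subseteq> carrier R" "u \<in> U" "v \<in> V"
  shows "u \<otimes> v \<in> sum_prod R U V"
  using sum_prod_add_product[OF assms(1,2) sum_prod_zero assms(3,4)] assms by (simp add: subset_iff)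

lemma sum_prod_induct [consumes 3, case_names zero add]:
  assumes "t \<in> sum_prod R U V" "U \<subseteq> carrier R" "V \<subseteq> carrier R"
    and zero: "Q \<zero>"
    and add: "\<And>s u v. \<lbrakk>s \<in> carrier R; Q s; u \<in> U; v \<in> V\<rbrakk> \<Longrightarrow> Q (s \<oplus> u \<otimes> v)"
  shows "Q t"
proof -
  obtain n :: nat and x y where t: "t = (\<Oplus>i\<in>{..<n}. x i \<otimes> y i)"
    and xy: "\<forall>i<n. x i \<in> U" "\<forall>i<n. y i \<in> V"
    using assms(1) unfolding sum_prod_def by blast
  have "m \<le> n \<Longrightarrow> Q (\<Oplus>i\<in>{..<m}. x i \<otimes> y i)" for m
  proof (induction m)
    case 0
    then show ?case using zero by simp
  next
    case (Suc m)
    have mem: "x i \<in> carrier R" "y i \<in> carrier R" if "i < Suc m" for i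
      using that Suc.prems xy assms(2,3) by auto
    have s: "(\<Oplus>i\<in>{..<m}. x i \<otimes> y i) \<in> carrier R"
      by (rule finsum_closed) (use mem in auto)
    have "(\<Oplus>i\<in>{..<Suc m}. x i \<otimes> y i) = x m \<otimes> y m \<oplus> (\<Oplus>i\<in>{..<m}. x i \<otimes> y i)"
      unfolding lessThan_Suc by (rule finsum_insert) (use mem in auto)
    also have "\<dots> = (\<Oplus>i\<in>{..<m}. x i \<otimes> y i) \<oplus> x m \<otimes> y m"
      using s mem by (simp add: a_comm)
    finally show ?case
      using add[OF s] Suc xy by simp
  qed
  then show ?thesis using t by blast
qed

lemma sum_prod_carrier:
  assumes "U \<subseteq> carrier R" "V \<subseteq> carrier R"
  shows "sum_prod R U V \<subseteq> carrier R"
proof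
  fix t assume "t \<in> sum_prod R U V"
  then show "t \<in> carrier R"
    using assms by (induction rule: sum_prod_induct) (use assms in \<open>auto intro!: a_closed m_closed\<close>)
qed

lemma sum_prod_eq_zero_iff:
  assumes "U \<subseteq> carrier R" "V \<subseteq> carrier R"
  shows "sum_prod R U V = {\<zero>} \<longleftrightarrow> (\<forall>u\<in>U. \<forall>v\<in>V. u \<otimes> v = \<zero>)"
proof
  assume "sum_prod R U V = {\<zero>}"
  then show "\<forall>u\<in>U. \<forall>v\<in>V. u \<otimes> v = \<zero>"
    using sum_prod_product[OF assms] by blast
next
  assume 0: "\<forall>u\<in>U. \<forall>v\<in>V. u \<otimes> v = \<zero>"
  have "t = \<zero>" if "t \<in> sum_prod R U V" for t
    using that assms by (induction rule: sum_prod_induct) (use 0 in auto)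
  then show "sum_prod R U V = {\<zero>}"
    using sum_prod_zero by blast
qed

lemma sum_prod_add:
  assumes UV: "U \<subseteq> carrier R" "V \<subseteq> carrier R"
    and "t \<in> sum_prod R U V" "s \<in> sum_prod R U V"
  shows "s \<oplus> t \<in> sum_prod R U V"
  using assms(3,1,2)
proof (induction rule: sum_prod_induct)
  case zero
  then show ?case using sum_prod_carrier[OF UV] assms(4) by auto
next
  case (add t u v)
  then have "s \<oplus> (t \<oplus> u \<otimes> v) = s \<oplus> t \<oplus> u \<otimes> v"
    using sum_prod_carrier[OF UV] assms(4) UV by (simp add: a_assoc subset_iff)
  then show ?case
    using add sum_prod_add_product[OF UV] by simp
qed

text \<open>In \<open>MN\<close> the left action of \<open>S\<close> is absorbed by the factor \<open>M\<close> and the right action by \<open>N\<close>;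
  negatives are absorbed by \<open>M\<close>. This is what makes \<open>R\<^sub>g R\<^sub>h\<close> accessible to the simplicity of
  \<open>R\<^bsub>gh\<^esub>\<close>.\<close>

lemma sum_prod_sub_bimodule:
  assumes M: "sub_bimodule R S M" and N: "sub_bimodule R S N" and S: "S \<subseteq> carrier R"
  shows "sub_bimodule R S (sum_prod R M N)"
proof -
  interpret M: additive_subgroup M R using M by (simp add: sub_bimodule_def)
  interpret N: additive_subgroup N R using N by (simp add: sub_bimodule_def)
  have c: "M \<subseteq> carrier R" "N \<subseteq> carrier R"
    using M.a_subset N.a_subset by auto
  note pc = sum_prod_carrier[OF c]
  note add = sum_prod_add[OF c]
  have neg: "\<ominus> t \<in> sum_prod R M N" if "t \<in> sum_prod R M N" for t
    using that c
  proof (induction rule: sum_prod_induct)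
    case zero
    then show ?case by (simp add: sum_prod_zero)
  next
    case (add t u v)
    then have "\<ominus> (t \<oplus> u \<otimes> v) = \<ominus> t \<oplus> (\<ominus> u) \<otimes> v"
      using c by (auto simp: minus_add l_minus subset_iff)
    then show ?case
      using add sum_prod_add_product[OF c] M.a_inv_closed by simp
  qed
  have act: "s \<otimes> t \<in> sum_prod R M N \<and> t \<otimes> s \<in> sum_prod R M N"
    if s: "s \<in> S" and t: "t \<in> sum_prod R M N" for s t
    using t c
  proof (induction rule: sum_prod_induct)
    case zero
    then show ?case using s S by (auto simp: sum_prod_zero)
  next
    case (add t u v)
    have [simp]: "s \<in> carrier R" "u \<in> carrier R" "v \<in> carrier R" "t \<in> carrier R"
      using add s S c by auto
    have "s \<otimes> (t \<oplus> u \<otimes> v) = s \<otimes> t \<oplus> (s \<otimes> u) \<otimes> v"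
      "(t \<oplus> u \<otimes> v) \<otimes> s = t \<otimes> s \<oplus> u \<otimes> (v \<otimes> s)"
      by (simp_all add: r_distr l_distr m_assoc)
    moreover have "s \<otimes> u \<in> M" "v \<otimes> s \<in> N"
      using M N s add by (auto simp: sub_bimodule_def)
    ultimately show ?case
      using add sum_prod_add_product[OF c] by simp
  qed
  have "subgroup (sum_prod R M N) (add_monoid R)"
    by (rule add.subgroupI) (use pc sum_prod_zero[of M N] neg add in \<open>auto simp: a_inv_def\<close>)
  then show ?thesis
    using act by (auto simp: sub_bimodule_def additive_subgroup_def)
qed

lemma family_sum_empty: "family_sum R {} B = {\<zero>}"
  unfolding family_sum_def by auto

lemma family_sum_component:
  assumes "i \<in> I" "x \<in> B i" "x \<in> carrier R"
  shows "x \<in> family_sum R I B"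
proof -
  have "x = (\<Oplus>j\<in>{i}. (\<lambda>_. x) j)" using assms by simp
  moreover have "(\<lambda>_. x) \<in> (\<Pi> j\<in>{i}. B j)" using assms by simp
  ultimately show ?thesis
    unfolding family_sum_def using assms(1) by blast
qed

lemma family_sum_induct [consumes 1, case_names carrier zero component add]:
  assumes "t \<in> family_sum R I B" "\<And>i. i \<in> I \<Longrightarrow> B i \<subseteq> carrier R"
    and zero: "Q \<zero>"
    and component: "\<And>i x. \<lbrakk>i \<in> I; x \<in> B i\<rbrakk> \<Longrightarrow> Q x"
    and add: "\<And>s t. \<lbrakk>s \<in> carrier R; t \<in> carrier R; Q s; Q t\<rbrakk> \<Longrightarrow> Q (s \<oplus> t)"
  shows "Q t"
proof -
  obtain F x where t: "t = (\<Oplus>i\<in>F. x i)" and F: "finite F" "F \<subseteq> I" and x: "x \<in> (\<Pi> i\<in>F. B i)"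
    using assms(1) unfolding family_sum_def by blast
  have "Q (\<Oplus>i\<in>F. x i)"
    using F x
  proof (induction F rule: finite_induct)
    case empty
    then show ?case using zero by simp
  next
    case (insert i F)
    have mem: "x j \<in> carrier R" if "j \<in> insert i F" for j
      using that insert.prems assms(2) by blast
    have "(\<Oplus>j\<in>insert i F. x j) = x i \<oplus> (\<Oplus>j\<in>F. x j)"
      by (rule finsum_insert) (use insert mem in auto)
    moreover have "(\<Oplus>j\<in>F. x j) \<in> carrier R"
      by (rule finsum_closed) (use mem in auto)
    ultimately show ?case
      using insert mem component add by auto
  qed
  then show ?thesis using t by simp
qed

lemma family_sum_least:
  assumes M: "additive_subgroup M R" and B: "\<And>i. i \<in> I \<Longrightarrow> B i \<subseteq> M"
  shows "family_sum R I B \<subseteq> M"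
proof
  interpret M: additive_subgroup M R by fact
  fix t assume "t \<in> family_sum R I B"
  then show "t \<in> M"
  proof (induction rule: family_sum_induct)
    show "B i \<subseteq> carrier R" if "i \<in> I" for i
      using B[OF that] M.a_subset by blast
  qed (use B in auto)
qed

lemma family_sum_singleton:
  assumes "additive_subgroup (B i) R"
  shows "family_sum R {i} B = B i"
  using family_sum_least[OF assms, of "{i}" B] family_sum_component[of i "{i}" _ B]
    additive_subgroup.a_subset[OF assms] by auto

end

section \<open>The unit of a graded ring\<close>

context graded_ring
begin

lemma component_carrier: "g \<in> carrier G \<Longrightarrow> A g \<subseteq> carrier R"
  by (rule additive_subgroup.a_subset[OF component_subgroup])

lemma component_closed [simp]: "\<lbrakk>x \<in> A g; g \<in> carrier G\<rbrakk> \<Longrightarrow> x \<in> carrier R"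
  using component_carrier by blast

lemma product_in_component:
  assumes "g \<in> carrier G" "h \<in> carrier G" "x \<in> A g" "y \<in> A h"
  shows "x \<otimes>\<^bsub>R\<^esub> y \<in> A (g \<otimes>\<^bsub>G\<^esub> h)"
  using R.sum_prod_product[OF component_carrier component_carrier] component_mult assms by blast

lemma component_sub_bimodule:
  assumes "g \<in> carrier G"
  shows "sub_bimodule R (A \<one>\<^bsub>G\<^esub>) (A g)"
  unfolding sub_bimodule_def
  using component_subgroup[OF assms] product_in_component[of "\<one>\<^bsub>G\<^esub>" g]
    product_in_component[of g "\<one>\<^bsub>G\<^esub>"] assms by auto

lemma carrier_family_sum: "carrier R = family_sum R (carrier G) A"
  using direct_sum by (simp add: internal_direct_sum_def)

text \<open>If \<open>y\<close> equals a finite sum over degrees in \<open>H\<close>, then adding \<open>-y\<close> as a term of the new degree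
  \<open>g\<close> gives a vanishing sum, and directness kills each term.\<close>

lemma component_Int_family_sum:
  assumes g: "g \<in> carrier G" and H: "H \<subseteq> carrier G" "g \<notin> H"
    and y: "y \<in> A g" "y \<in> family_sum R H A"
  shows "y = \<zero>\<^bsub>R\<^esub>"
proof -
  interpret Ag: additive_subgroup "A g" R by (rule component_subgroup[OF g])
  obtain F x where yF: "y = (\<Oplus>\<^bsub>R\<^esub>i\<in>F. x i)" and F: "finite F" "F \<subseteq> H"
    and x: "x \<in> (\<Pi> i\<in>F. A i)"
    using y(2) unfolding family_sum_def by blast
  have gF: "g \<notin> F" using F H by blast
  let ?x = "x(g := \<ominus>\<^bsub>R\<^esub> y)"
  have mem: "x i \<in> carrier R" if "i \<in> F" for i
    using that x F H component_carrier by blast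
  have "(\<Oplus>\<^bsub>R\<^esub>i\<in>F. ?x i) = y"
    unfolding yF by (rule R.add.finprod_cong') (use mem gF in auto)
  moreover have "(\<Oplus>\<^bsub>R\<^esub>i\<in>insert g F. ?x i) = ?x g \<oplus>\<^bsub>R\<^esub> (\<Oplus>\<^bsub>R\<^esub>i\<in>F. ?x i)"
    by (rule R.finsum_insert) (use F gF mem y g in auto)
  ultimately have "(\<Oplus>\<^bsub>R\<^esub>i\<in>insert g F. ?x i) = \<zero>\<^bsub>R\<^esub>"
    using y g by (simp add: R.l_neg)
  moreover have "?x \<in> (\<Pi> i\<in>insert g F. A i)"
    using x y Ag.a_inv_closed gF by auto
  moreover have "finite (insert g F)" "insert g F \<subseteq> carrier G"
    using F H g by auto
  ultimately have "?x g = \<zero>\<^bsub>R\<^esub>"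
    using direct_sum unfolding internal_direct_sum_def by blast
  then show ?thesis using y g by simp
qed

lemma family_sum_add:
  assumes H: "H \<subseteq> carrier G" and s: "s \<in> family_sum R H A" and t: "t \<in> family_sum R H A"
  shows "s \<oplus>\<^bsub>R\<^esub> t \<in> family_sum R H A"
proof -
  obtain F x where sF: "s = (\<Oplus>\<^bsub>R\<^esub>i\<in>F. x i)" and F: "finite F" "F \<subseteq> H"
    and x: "x \<in> (\<Pi> i\<in>F. A i)"
    using s unfolding family_sum_def by blast
  obtain F' x' where tF: "t = (\<Oplus>\<^bsub>R\<^esub>i\<in>F'. x' i)" and F': "finite F'" "F' \<subseteq> H"
    and x': "x' \<in> (\<Pi> i\<in>F'. A i)"
    using t unfolding family_sum_def by blast
  have zero: "\<zero>\<^bsub>R\<^esub> \<in> A i" if "i \<in> H" for i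
    using additive_subgroup.zero_closed[OF component_subgroup] that H by blast
  have mem: "z \<in> carrier R" if "z \<in> A i" "i \<in> H" for z i
    using that H by auto
  let ?y = "\<lambda>i. if i \<in> F then x i else \<zero>\<^bsub>R\<^esub>" and ?y' = "\<lambda>i. if i \<in> F' then x' i else \<zero>\<^bsub>R\<^esub>"
  have y: "?y \<in> (\<Pi> i\<in>F \<union> F'. A i)" "?y' \<in> (\<Pi> i\<in>F \<union> F'. A i)"
    using x x' zero F F' by (auto simp: Pi_iff subset_iff)
  have c: "?y \<in> F \<union> F' \<rightarrow> carrier R" "?y' \<in> F \<union> F' \<rightarrow> carrier R"
    using y F F' mem by blast+
  have "s = (\<Oplus>\<^bsub>R\<^esub>i\<in>F \<union> F'. ?y i)"
    unfolding sF by (rule R.add.finprod_mono_neutral_cong_left) (use F F' c x mem in auto)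
  moreover have "t = (\<Oplus>\<^bsub>R\<^esub>i\<in>F \<union> F'. ?y' i)"
    unfolding tF by (rule R.add.finprod_mono_neutral_cong_left) (use F F' c x' mem in auto)
  ultimately have "s \<oplus>\<^bsub>R\<^esub> t = (\<Oplus>\<^bsub>R\<^esub>i\<in>F \<union> F'. ?y i \<oplus>\<^bsub>R\<^esub> ?y' i)"
    using R.finsum_addf[OF c] by simp
  moreover have "(\<lambda>i. ?y i \<oplus>\<^bsub>R\<^esub> ?y' i) \<in> (\<Pi> i\<in>F \<union> F'. A i)"
  proof (rule Pi_I)
    fix i assume i: "i \<in> F \<union> F'"
    then have "additive_subgroup (A i) R"
      using F F' H component_subgroup by blast
    moreover have "?y i \<in> A i" "?y' i \<in> A i"
      using y i by (blast dest: Pi_mem)+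
    ultimately show "?y i \<oplus>\<^bsub>R\<^esub> ?y' i \<in> A i"
      by (rule additive_subgroup.a_closed)
  qed
  moreover have "finite (F \<union> F')" "F \<union> F' \<subseteq> H"
    using F F' by auto
  ultimately show ?thesis
    unfolding family_sum_def by blast
qed

text \<open>Write \<open>1 = u + v\<close> with \<open>u\<close> of degree \<open>e\<close> and \<open>v\<close> supported off \<open>e\<close>. For \<open>x\<close> of degree \<open>h\<close>
  the element \<open>x - ux = vx\<close> has degree \<open>h\<close> and is supported off \<open>h\<close>, so it vanishes. Hence \<open>u\<close>
  is a left unit on all of \<open>R\<close>, and \<open>u = 1\<close>.\<close>

lemma one_in_neutral_component: "\<one>\<^bsub>R\<^esub> \<in> A \<one>\<^bsub>G\<^esub>"
proof -
  let ?H = "carrier G - {\<one>\<^bsub>G\<^esub>}"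
  have "\<one>\<^bsub>R\<^esub> \<in> family_sum R (carrier G) A"
    using carrier_family_sum by blast
  then obtain F x where one: "\<one>\<^bsub>R\<^esub> = (\<Oplus>\<^bsub>R\<^esub>i\<in>F. x i)" and F: "finite F" "F \<subseteq> carrier G"
    and x: "x \<in> (\<Pi> i\<in>F. A i)"
    unfolding family_sum_def by blast
  define v where "v = (\<Oplus>\<^bsub>R\<^esub>i\<in>F - {\<one>\<^bsub>G\<^esub>}. x i)"
  have mem: "x i \<in> carrier R" if "i \<in> F" for i
    using that x F component_carrier by blast
  have vH: "v \<in> family_sum R ?H A"
    unfolding family_sum_def v_def using F x by blast
  have v: "v \<in> carrier R"
    unfolding v_def by (rule R.finsum_closed) (use mem in auto)
  have "\<exists>u\<in>A \<one>\<^bsub>G\<^esub>. \<one>\<^bsub>R\<^esub> = u \<oplus>\<^bsub>R\<^esub> v"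
  proof (cases "\<one>\<^bsub>G\<^esub> \<in> F")
    case True
    then have "(\<Oplus>\<^bsub>R\<^esub>i\<in>F. x i) = (\<Oplus>\<^bsub>R\<^esub>i\<in>insert \<one>\<^bsub>G\<^esub> (F - {\<one>\<^bsub>G\<^esub>}). x i)"
      by (simp add: insert_absorb)
    also have "\<dots> = x \<one>\<^bsub>G\<^esub> \<oplus>\<^bsub>R\<^esub> v"
      unfolding v_def by (rule R.finsum_insert) (use F mem True in auto)
    finally show ?thesis using one True x by auto
  next
    case False
    then have "\<one>\<^bsub>R\<^esub> = \<zero>\<^bsub>R\<^esub> \<oplus>\<^bsub>R\<^esub> v" using one v v_def by simp
    then show ?thesis
      using additive_subgroup.zero_closed[OF component_subgroup] by blast
  qed
  then obtain u where u: "u \<in> A \<one>\<^bsub>G\<^esub>" and uv: "\<one>\<^bsub>R\<^esub> = u \<oplus>\<^bsub>R\<^esub> v"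
    by blast
  have uc [simp]: "u \<in> carrier R" using u by auto
  have u_hom: "u \<otimes>\<^bsub>R\<^esub> y = y" if h: "h \<in> carrier G" and y: "y \<in> A h" for h y
  proof -
    interpret Ah: additive_subgroup "A h" R by (rule component_subgroup[OF h])
    let ?K = "carrier G - {h}"
    have yc [simp]: "y \<in> carrier R" using h y by auto
    have eq: "y = u \<otimes>\<^bsub>R\<^esub> y \<oplus>\<^bsub>R\<^esub> v \<otimes>\<^bsub>R\<^esub> y"
      using v uv by (metis R.l_distr R.l_one uc yc)
    have "v \<otimes>\<^bsub>R\<^esub> y \<in> family_sum R ?K A"
      using vH
    proof (induction rule: R.family_sum_induct)
      show "A i \<subseteq> carrier R" if "i \<in> ?H" for i
        using that component_carrier by blast
    next
      case zero
      have "\<zero>\<^bsub>R\<^esub> = (\<Oplus>\<^bsub>R\<^esub>i\<in>{}. undefined i)" by simp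
      then have "\<zero>\<^bsub>R\<^esub> \<in> family_sum R ?K A" unfolding family_sum_def by blast
      then show ?case by simp
    next
      case (component i z)
      then have "i \<otimes>\<^bsub>G\<^esub> h \<in> ?K"
        using h by (metis DiffD1 DiffD2 DiffI G.m_closed G.r_cancel_one singletonD singletonI)
      moreover have "z \<otimes>\<^bsub>R\<^esub> y \<in> A (i \<otimes>\<^bsub>G\<^esub> h)"
        using product_in_component component h y by blast
      ultimately show ?case
        using R.family_sum_component[where B=A and I="?K"] by simp
    next
      case (add s t)
      then have "s \<otimes>\<^bsub>R\<^esub> y \<oplus>\<^bsub>R\<^esub> t \<otimes>\<^bsub>R\<^esub> y \<in> family_sum R ?K A"
        by (intro family_sum_add) auto
      then show ?case using add by (simp add: R.l_distr)
    qed
    moreover have "v \<otimes>\<^bsub>R\<^esub> y \<in> A h"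
    proof -
      have uy: "u \<otimes>\<^bsub>R\<^esub> y \<in> A h"
        using product_in_component[OF _ h u y] h by simp
      have "v \<otimes>\<^bsub>R\<^esub> y = \<ominus>\<^bsub>R\<^esub> (u \<otimes>\<^bsub>R\<^esub> y) \<oplus>\<^bsub>R\<^esub> y"
        using eq v by (metis R.m_closed R.r_neg1 uc yc)
      then show ?thesis
        using uy y by simp
    qed
    ultimately have "v \<otimes>\<^bsub>R\<^esub> y = \<zero>\<^bsub>R\<^esub>"
      using component_Int_family_sum[OF h, of ?K] by blast
    then show ?thesis using eq by simp
  qed
  have "\<one>\<^bsub>R\<^esub> \<in> family_sum R (carrier G) A"
    using carrier_family_sum by blast
  then have "u \<otimes>\<^bsub>R\<^esub> \<one>\<^bsub>R\<^esub> = \<one>\<^bsub>R\<^esub>"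
    by (induction rule: R.family_sum_induct) (use component_carrier u_hom in \<open>auto simp: R.r_distr\<close>)
  then show ?thesis using u by simp
qed

definition nonvanishing :: "'g \<Rightarrow> 'g \<Rightarrow> bool" where
  "nonvanishing g h \<longleftrightarrow> (\<exists>x\<in>A g. \<exists>y\<in>A h. x \<otimes>\<^bsub>R\<^esub> y \<noteq> \<zero>\<^bsub>R\<^esub>)"

lemma nonvanishing_iff_sum_prod:
  "\<lbrakk>g \<in> carrier G; h \<in> carrier G\<rbrakk> \<Longrightarrow>
     nonvanishing g h \<longleftrightarrow> sum_prod R (A g) (A h) \<noteq> {\<zero>\<^bsub>R\<^esub>}"
  by (simp add: nonvanishing_def R.sum_prod_eq_zero_iff component_carrier)

end

section \<open>Components of a controlled gradation\<close>

locale controlled_graded_ring = graded_ring +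
  assumes controlled: "controlled G R A"
begin

lemma family_sum_bij:
  "bij_betw (\<lambda>H. family_sum R H A) (Pow (carrier G)) {M. sub_bimodule R (A \<one>\<^bsub>G\<^esub>) M}"
  using controlled by (simp add: controlled_def)

lemma family_sum_subgroup:
  assumes "H \<subseteq> carrier G"
  shows "additive_subgroup (family_sum R H A) R"
  using bij_betw_apply[OF family_sum_bij, of H] assms by (simp add: sub_bimodule_def)

lemma sub_bimodule_obtains:
  assumes "sub_bimodule R (A \<one>\<^bsub>G\<^esub>) M"
  obtains H where "H \<subseteq> carrier G" "M = family_sum R H A"
  using bij_betw_imp_surj_on[OF family_sum_bij] assms by blast

lemma component_nonzero:
  assumes "g \<in> carrier G"
  shows "\<exists>x\<in>A g. x \<noteq> \<zero>\<^bsub>R\<^esub>"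
proof (rule ccontr)
  assume "\<not> ?thesis"
  then have "A g = {\<zero>\<^bsub>R\<^esub>}"
    using additive_subgroup.zero_closed[OF component_subgroup[OF assms]] by blast
  then have "family_sum R {g} A = family_sum R {} A"
    using R.family_sum_singleton[where B=A, OF component_subgroup[OF assms]]
    by (simp add: R.family_sum_empty)
  moreover have "{g} \<in> Pow (carrier G)" "{} \<in> Pow (carrier G)"
    using assms by auto
  ultimately have "{g} = {}"
    by (rule inj_onD[OF bij_betw_imp_inj_on[OF family_sum_bij]])
  then show False by simp
qed

text \<open>A sub-bimodule of \<open>R\<^sub>g\<close> is some \<open>R\<^sub>H\<close>, and directness leaves only \<open>H = {}\<close> and \<open>H = {g}\<close>.\<close>

lemma component_simple:
  assumes g: "g \<in> carrier G" and M: "sub_bimodule R (A \<one>\<^bsub>G\<^esub>) M" "M \<subseteq> A g" "M \<noteq> {\<zero>\<^bsub>R\<^esub>}"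
  shows "M = A g"
proof -
  obtain H where H: "H \<subseteq> carrier G" "M = family_sum R H A"
    using M(1) by (rule sub_bimodule_obtains)
  then have "H \<noteq> {}"
    using M(3) R.family_sum_empty by metis
  then obtain h where h: "h \<in> H" by blast
  then have hG: "h \<in> carrier G" using H by blast
  have AhM: "A h \<subseteq> M"
    unfolding H(2) using R.family_sum_component[where B=A, OF h] hG by auto
  obtain x where x: "x \<in> A h" "x \<noteq> \<zero>\<^bsub>R\<^esub>"
    using component_nonzero[OF hG] by blast
  have "x \<in> family_sum R {g} A"
    using x AhM M(2) R.family_sum_singleton[where B=A, OF component_subgroup[OF g]] by blast
  then have "h = g"
    using component_Int_family_sum[OF hG, of "{g}" x] x g by blast
  then show ?thesis using AhM M(2) by blast
qed

lemma nonvanishing_sum_prod: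
  assumes "g \<in> carrier G" "h \<in> carrier G" "nonvanishing g h"
  shows "sum_prod R (A g) (A h) = A (g \<otimes>\<^bsub>G\<^esub> h)"
proof (rule component_simple)
  show "sub_bimodule R (A \<one>\<^bsub>G\<^esub>) (sum_prod R (A g) (A h))"
    by (intro R.sum_prod_sub_bimodule component_sub_bimodule component_carrier assms G.one_closed)
  show "sum_prod R (A g) (A h) \<subseteq> A (g \<otimes>\<^bsub>G\<^esub> h)"
    by (rule component_mult[OF assms(1,2)])
  show "sum_prod R (A g) (A h) \<noteq> {\<zero>\<^bsub>R\<^esub>}"
    using nonvanishing_iff_sum_prod assms by blast
  show "g \<otimes>\<^bsub>G\<^esub> h \<in> carrier G"
    using assms by simp
qed

section \<open>Calculus of non-vanishing products\<close>

text \<open>If \<open>(R\<^sub>a R\<^sub>b) R\<^sub>c \<noteq> 0\<close>, then some triple product \<open>xyz\<close> of elements of degrees \<open>a\<close>, \<open>b\<close>, \<open>c\<close> is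
  non-zero, and \<open>yz\<close> and \<open>x(yz)\<close> witness the conclusions. Simplicity of \<open>R\<^bsub>ab\<^esub>\<close> enters because the
  given non-zero product has an arbitrary element of \<open>R\<^bsub>ab\<^esub>\<close> as its left factor.\<close>

lemma nonvanishing_assoc_right:
  assumes G: "a \<in> carrier G" "b \<in> carrier G" "c \<in> carrier G"
    and ab: "nonvanishing a b" and abc: "nonvanishing (a \<otimes>\<^bsub>G\<^esub> b) c"
  shows "nonvanishing b c \<and> nonvanishing a (b \<otimes>\<^bsub>G\<^esub> c)"
proof -
  obtain w z where w: "w \<in> A (a \<otimes>\<^bsub>G\<^esub> b)" and z: "z \<in> A c" and wz: "w \<otimes>\<^bsub>R\<^esub> z \<noteq> \<zero>\<^bsub>R\<^esub>"
    using abc unfolding nonvanishing_def by blast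
  have "\<exists>x\<in>A a. \<exists>y\<in>A b. x \<otimes>\<^bsub>R\<^esub> y \<otimes>\<^bsub>R\<^esub> z \<noteq> \<zero>\<^bsub>R\<^esub>"
  proof (rule ccontr)
    assume 0: "\<not> ?thesis"
    have "w \<in> sum_prod R (A a) (A b)"
      using nonvanishing_sum_prod[OF G(1,2) ab] w by simp
    then have "w \<otimes>\<^bsub>R\<^esub> z = \<zero>\<^bsub>R\<^esub>"
      using component_carrier[OF G(1)] component_carrier[OF G(2)]
      by (induction rule: R.sum_prod_induct) (use 0 G z in \<open>auto simp: R.l_distr\<close>)
    then show False using wz by simp
  qed
  then obtain x y where x: "x \<in> A a" and y: "y \<in> A b" and xyz: "x \<otimes>\<^bsub>R\<^esub> y \<otimes>\<^bsub>R\<^esub> z \<noteq> \<zero>\<^bsub>R\<^esub>"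
    by blast
  have "x \<otimes>\<^bsub>R\<^esub> (y \<otimes>\<^bsub>R\<^esub> z) \<noteq> \<zero>\<^bsub>R\<^esub>"
    using xyz x y z G by (simp add: R.m_assoc)
  moreover from this have "y \<otimes>\<^bsub>R\<^esub> z \<noteq> \<zero>\<^bsub>R\<^esub>"
    using x G by auto
  ultimately show ?thesis
    unfolding nonvanishing_def using x y z product_in_component[OF G(2,3) y z] by blast
qed

lemma nonvanishing_assoc_left:
  assumes G: "a \<in> carrier G" "b \<in> carrier G" "c \<in> carrier G"
    and bc: "nonvanishing b c" and abc: "nonvanishing a (b \<otimes>\<^bsub>G\<^esub> c)"
  shows "nonvanishing a b \<and> nonvanishing (a \<otimes>\<^bsub>G\<^esub> b) c"
proof -
  obtain x w where w: "w \<in> A (b \<otimes>\<^bsub>G\<^esub> c)" and x: "x \<in> A a" and xw: "x \<otimes>\<^bsub>R\<^esub> w \<noteq> \<zero>\<^bsub>R\<^esub>"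
    using abc unfolding nonvanishing_def by blast
  have "\<exists>y\<in>A b. \<exists>z\<in>A c. x \<otimes>\<^bsub>R\<^esub> (y \<otimes>\<^bsub>R\<^esub> z) \<noteq> \<zero>\<^bsub>R\<^esub>"
  proof (rule ccontr)
    assume 0: "\<not> ?thesis"
    have "w \<in> sum_prod R (A b) (A c)"
      using nonvanishing_sum_prod[OF G(2,3) bc] w by simp
    then have "x \<otimes>\<^bsub>R\<^esub> w = \<zero>\<^bsub>R\<^esub>"
      using component_carrier[OF G(2)] component_carrier[OF G(3)]
      by (induction rule: R.sum_prod_induct) (use 0 G x in \<open>auto simp: R.r_distr\<close>)
    then show False using xw by simp
  qed
  then obtain y z where y: "y \<in> A b" and z: "z \<in> A c" and xyz: "x \<otimes>\<^bsub>R\<^esub> (y \<otimes>\<^bsub>R\<^esub> z) \<noteq> \<zero>\<^bsub>R\<^esub>"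
    by blast
  have "x \<otimes>\<^bsub>R\<^esub> y \<otimes>\<^bsub>R\<^esub> z \<noteq> \<zero>\<^bsub>R\<^esub>"
    using xyz x y z G by (simp add: R.m_assoc)
  moreover from this have "x \<otimes>\<^bsub>R\<^esub> y \<noteq> \<zero>\<^bsub>R\<^esub>"
    using z G by auto
  ultimately show ?thesis
    unfolding nonvanishing_def using x y z product_in_component[OF G(1,2) x y] by blast
qed

lemma nonvanishing_one:
  assumes "g \<in> carrier G"
  shows "nonvanishing \<one>\<^bsub>G\<^esub> g" "nonvanishing g \<one>\<^bsub>G\<^esub>"
proof -
  obtain x where x: "x \<in> A g" "x \<noteq> \<zero>\<^bsub>R\<^esub>"
    using component_nonzero[OF assms] by blast
  then have "\<one>\<^bsub>R\<^esub> \<otimes>\<^bsub>R\<^esub> x \<noteq> \<zero>\<^bsub>R\<^esub>" "x \<otimes>\<^bsub>R\<^esub> \<one>\<^bsub>R\<^esub> \<noteq> \<zero>\<^bsub>R\<^esub>"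
    using assms by auto
  then show "nonvanishing \<one>\<^bsub>G\<^esub> g" "nonvanishing g \<one>\<^bsub>G\<^esub>"
    unfolding nonvanishing_def using x one_in_neutral_component by blast+
qed

text \<open>\<open>R\<^sub>a R\<^bsub>a\<^sup>-\<^sup>1\<^esub> R\<^sub>a = R\<^sub>e R\<^sub>a \<noteq> 0\<close>, so its right-hand pair of factors does not annihilate.\<close>

lemma nonvanishing_inv_flip:
  assumes a: "a \<in> carrier G" and "nonvanishing a (inv\<^bsub>G\<^esub> a)"
  shows "nonvanishing (inv\<^bsub>G\<^esub> a) a"
proof -
  have "nonvanishing (a \<otimes>\<^bsub>G\<^esub> inv\<^bsub>G\<^esub> a) a"
    using a nonvanishing_one by simp
  then show ?thesis
    using nonvanishing_assoc_right assms by blast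
qed

section \<open>Strong gradedness\<close>

text \<open>Given \<open>R\<^sub>g R\<^bsub>g\<^sup>-\<^sup>1\<^esub> \<noteq> 0\<close>, the product \<open>R\<^sub>g R\<^bsub>g\<^sup>-\<^sup>1\<^esub> R\<^bsub>gh\<^esub> = R\<^sub>e R\<^bsub>gh\<^esub>\<close> is non-zero;
  bracketing it the other way makes \<open>R\<^sub>g R\<^sub>h\<close> non-zero.\<close>

lemma strongly_graded_iff_nonvanishing_inv:
  "strongly_graded G R A \<longleftrightarrow> (\<forall>g\<in>carrier G. nonvanishing g (inv\<^bsub>G\<^esub> g))"
proof
  assume s: "strongly_graded G R A"
  show "\<forall>g\<in>carrier G. nonvanishing g (inv\<^bsub>G\<^esub> g)"
  proof
    fix g assume g: "g \<in> carrier G"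
    then have "sum_prod R (A g) (A (inv\<^bsub>G\<^esub> g)) = A \<one>\<^bsub>G\<^esub>"
      using s unfolding strongly_graded_def by (metis G.inv_closed G.r_inv)
    moreover have "A \<one>\<^bsub>G\<^esub> \<noteq> {\<zero>\<^bsub>R\<^esub>}"
      using component_nonzero[OF G.one_closed] by blast
    ultimately show "nonvanishing g (inv\<^bsub>G\<^esub> g)"
      using nonvanishing_iff_sum_prod g by simp
  qed
next
  assume inv: "\<forall>g\<in>carrier G. nonvanishing g (inv\<^bsub>G\<^esub> g)"
  have "nonvanishing g h" if g: "g \<in> carrier G" and h: "h \<in> carrier G" for g h
  proof -
    have "nonvanishing (g \<otimes>\<^bsub>G\<^esub> inv\<^bsub>G\<^esub> g) (g \<otimes>\<^bsub>G\<^esub> h)"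
      using g h nonvanishing_one by simp
    then have "nonvanishing g (inv\<^bsub>G\<^esub> g \<otimes>\<^bsub>G\<^esub> (g \<otimes>\<^bsub>G\<^esub> h))"
      using nonvanishing_assoc_right[of g "inv\<^bsub>G\<^esub> g" "g \<otimes>\<^bsub>G\<^esub> h"] inv g h by simp
    then show ?thesis
      using g h by (simp add: G.m_assoc[symmetric])
  qed
  then show "strongly_graded G R A"
    unfolding strongly_graded_def using nonvanishing_sum_prod graded_ring_axioms by blast
qed

lemma right_nondegenerate_imp_nonvanishing_inv:
  assumes "right_nondegenerate G R A" "g \<in> carrier G"
  shows "nonvanishing g (inv\<^bsub>G\<^esub> g)"
proof -
  obtain x where x: "x \<in> A g" "x \<noteq> \<zero>\<^bsub>R\<^esub>"
    using component_nonzero[OF assms(2)] by blast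
  then have "sum_prod R {x} (A (inv\<^bsub>G\<^esub> g)) \<noteq> {\<zero>\<^bsub>R\<^esub>}"
    using assms unfolding right_nondegenerate_def by blast
  moreover have "{x} \<subseteq> carrier R" "A (inv\<^bsub>G\<^esub> g) \<subseteq> carrier R"
    using x assms component_carrier by auto
  ultimately show ?thesis
    unfolding nonvanishing_def using x R.sum_prod_eq_zero_iff by blast
qed

text \<open>If \<open>R\<^bsub>g\<^sup>-\<^sup>1\<^esub> x = 0\<close>, then \<open>x = 1 x \<in> R\<^sub>g R\<^bsub>g\<^sup>-\<^sup>1\<^esub> x = 0\<close>, and symmetrically on the right, where
  \<open>R\<^bsub>g\<^sup>-\<^sup>1\<^esub> R\<^sub>g = R\<^sub>e\<close> is used.\<close>

lemma strongly_graded_imp_nondegenerate: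
  assumes s: "strongly_graded G R A"
  shows "left_nondegenerate G R A" "right_nondegenerate G R A"
proof -
  have one: "\<one>\<^bsub>R\<^esub> \<in> sum_prod R (A g) (A (inv\<^bsub>G\<^esub> g))" "\<one>\<^bsub>R\<^esub> \<in> sum_prod R (A (inv\<^bsub>G\<^esub> g)) (A g)"
    if "g \<in> carrier G" for g
    using s that one_in_neutral_component unfolding strongly_graded_def by auto
  show "left_nondegenerate G R A"
    unfolding left_nondegenerate_def
  proof (intro ballI notI)
    fix g x assume g: "g \<in> carrier G" and x: "x \<in> A g - {\<zero>\<^bsub>R\<^esub>}"
      and 0: "sum_prod R (A (inv\<^bsub>G\<^esub> g)) {x} = {\<zero>\<^bsub>R\<^esub>}"
    have xc: "x \<in> carrier R" and Ac: "A g \<subseteq> carrier R" "A (inv\<^bsub>G\<^esub> g) \<subseteq> carrier R"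
      using g x component_carrier by auto
    have yx: "y \<otimes>\<^bsub>R\<^esub> x = \<zero>\<^bsub>R\<^esub>" if "y \<in> A (inv\<^bsub>G\<^esub> g)" for y
      using 0 R.sum_prod_eq_zero_iff[OF Ac(2), of "{x}"] xc that by auto
    have "\<one>\<^bsub>R\<^esub> \<otimes>\<^bsub>R\<^esub> x = \<zero>\<^bsub>R\<^esub>"
      using one(1)[OF g] Ac
      by (induction rule: R.sum_prod_induct)
        (use xc yx Ac in \<open>auto simp: R.l_distr R.m_assoc subset_iff\<close>)
    then show False using x xc by simp
  qed
  show "right_nondegenerate G R A"
    unfolding right_nondegenerate_def
  proof (intro ballI notI)
    fix g x assume g: "g \<in> carrier G" and x: "x \<in> A g - {\<zero>\<^bsub>R\<^esub>}"
      and 0: "sum_prod R {x} (A (inv\<^bsub>G\<^esub> g)) = {\<zero>\<^bsub>R\<^esub>}"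
    have xc: "x \<in> carrier R" and Ac: "A g \<subseteq> carrier R" "A (inv\<^bsub>G\<^esub> g) \<subseteq> carrier R"
      using g x component_carrier by auto
    have xy: "x \<otimes>\<^bsub>R\<^esub> y = \<zero>\<^bsub>R\<^esub>" if "y \<in> A (inv\<^bsub>G\<^esub> g)" for y
      using 0 R.sum_prod_eq_zero_iff[OF _ Ac(2), of "{x}"] xc that by auto
    have "x \<otimes>\<^bsub>R\<^esub> \<one>\<^bsub>R\<^esub> = \<zero>\<^bsub>R\<^esub>"
      using one(2)[OF g] Ac(2,1)
      by (induction rule: R.sum_prod_induct)
        (use xc xy Ac in \<open>auto simp: R.r_distr R.m_assoc[symmetric] subset_iff\<close>)
    then show False using x xc by simp
  qed
qed

section \<open>Ideals\<close>

lemma ideal_obtains: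
  assumes "ideal I R"
  obtains H where "H \<subseteq> carrier G" "I = family_sum R H A"
proof -
  interpret I: ideal I R by fact
  have "sub_bimodule R (A \<one>\<^bsub>G\<^esub>) I"
    unfolding sub_bimodule_def
    using I.I_l_closed I.I_r_closed I.additive_subgroup_axioms by auto
  then show thesis using sub_bimodule_obtains that by blast
qed

text \<open>\<open>R\<^sub>H\<close> contains the components of each of its elements, because \<open>R\<^sub>h \<subseteq> R\<^sub>H\<close> for \<open>h \<in> H\<close>;
  directness is inherited from \<open>R\<close>.\<close>

lemma ideal_graded:
  assumes I: "ideal I R"
  shows "graded_ideal G R A I"
proof -
  interpret I: ideal I R by fact
  obtain H where H: "H \<subseteq> carrier G" "I = family_sum R H A"
    using ideal_obtains[OF I] .
  have comp: "A h \<subseteq> I" if "h \<in> H" for h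
    unfolding H(2) using R.family_sum_component[where B=A, OF that] that H(1) by auto
  have "I \<subseteq> family_sum R (carrier G) (\<lambda>g. I \<inter> A g)"
  proof
    fix t assume "t \<in> I"
    then obtain F x where t: "t = (\<Oplus>\<^bsub>R\<^esub>i\<in>F. x i)" and F: "finite F" "F \<subseteq> H"
      and x: "x \<in> (\<Pi> i\<in>F. A i)"
      unfolding H(2) family_sum_def by blast
    have "x \<in> (\<Pi> i\<in>F. I \<inter> A i)" "F \<subseteq> carrier G"
      using x F comp H(1) by blast+
    then show "t \<in> family_sum R (carrier G) (\<lambda>g. I \<inter> A g)"
      unfolding family_sum_def using t F by blast
  qed
  moreover have "family_sum R (carrier G) (\<lambda>g. I \<inter> A g) \<subseteq> I"
    by (rule R.family_sum_least[OF I.additive_subgroup_axioms]) simp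
  moreover have "\<forall>i\<in>F. x i = \<zero>\<^bsub>R\<^esub>"
    if "finite F" "F \<subseteq> carrier G" "x \<in> (\<Pi> i\<in>F. I \<inter> A i)" "(\<Oplus>\<^bsub>R\<^esub>i\<in>F. x i) = \<zero>\<^bsub>R\<^esub>" for F x
  proof -
    have "x \<in> (\<Pi> i\<in>F. A i)" using that(3) by blast
    then show ?thesis
      using direct_sum that unfolding internal_direct_sum_def by blast
  qed
  ultimately show ?thesis
    unfolding graded_ideal_def internal_direct_sum_def using I by blast
qed

lemma family_sum_ideal:
  assumes H: "H \<subseteq> carrier G"
    and left: "\<And>c h. \<lbrakk>c \<in> carrier G; h \<in> H; nonvanishing c h\<rbrakk> \<Longrightarrow> c \<otimes>\<^bsub>G\<^esub> h \<in> H"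
    and right: "\<And>c h. \<lbrakk>c \<in> carrier G; h \<in> H; nonvanishing h c\<rbrakk> \<Longrightarrow> h \<otimes>\<^bsub>G\<^esub> c \<in> H"
  shows "ideal (family_sum R H A) R"
proof -
  let ?M = "family_sum R H A"
  interpret M: additive_subgroup ?M R by (rule family_sum_subgroup[OF H])
  have homogeneous: "r \<otimes>\<^bsub>R\<^esub> x \<in> ?M \<and> x \<otimes>\<^bsub>R\<^esub> r \<in> ?M"
    if c: "c \<in> carrier G" "r \<in> A c" and h: "h \<in> H" "x \<in> A h" for c r h x
  proof -
    have hG: "h \<in> carrier G" using h H by blast
    have "r \<otimes>\<^bsub>R\<^esub> x \<in> ?M"
    proof (cases "r \<otimes>\<^bsub>R\<^esub> x = \<zero>\<^bsub>R\<^esub>")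
      case False
      then have "c \<otimes>\<^bsub>G\<^esub> h \<in> H" using left c h unfolding nonvanishing_def by blast
      then show ?thesis
        using R.family_sum_component[where B=A] product_in_component[OF c(1) hG c(2) h(2)] c hG
        by simp
    qed simp
    moreover have "x \<otimes>\<^bsub>R\<^esub> r \<in> ?M"
    proof (cases "x \<otimes>\<^bsub>R\<^esub> r = \<zero>\<^bsub>R\<^esub>")
      case False
      then have "h \<otimes>\<^bsub>G\<^esub> c \<in> H" using right c h unfolding nonvanishing_def by blast
      then show ?thesis
        using R.family_sum_component[where B=A] product_in_component[OF hG c(1) h(2) c(2)] c hG
        by simp
    qed simp
    ultimately show ?thesis ..
  qed
  have mixed: "r \<otimes>\<^bsub>R\<^esub> x \<in> ?M \<and> x \<otimes>\<^bsub>R\<^esub> r \<in> ?M"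
    if r: "r \<in> carrier R" and h: "h \<in> H" "x \<in> A h" for r h x
  proof -
    have xc: "x \<in> carrier R" using h H by auto
    have "r \<in> family_sum R (carrier G) A" using r carrier_family_sum by simp
    then show ?thesis
      by (induction rule: R.family_sum_induct)
        (use component_carrier homogeneous h xc in \<open>auto simp: R.l_distr R.r_distr\<close>)
  qed
  have "r \<otimes>\<^bsub>R\<^esub> x \<in> ?M \<and> x \<otimes>\<^bsub>R\<^esub> r \<in> ?M" if r: "r \<in> carrier R" and x: "x \<in> ?M" for r x
    using x
  proof (induction rule: R.family_sum_induct)
    show "A i \<subseteq> carrier R" if "i \<in> H" for i
      using that H component_carrier by blast
  qed (use mixed r in \<open>auto simp: R.l_distr R.r_distr\<close>)
  then show ?thesis
    by (intro idealI) (use R.ring_axioms M.a_subgroup in auto)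
qed

lemma strongly_graded_imp_simple:
  assumes s: "strongly_graded G R A"
  shows "simple_ring R"
  unfolding simple_ring_def
proof (intro conjI allI impI R.ring_axioms)
  fix I assume I: "ideal I R"
  interpret I: ideal I R by fact
  obtain H where H: "H \<subseteq> carrier G" "I = family_sum R H A"
    using ideal_obtains[OF I] .
  show "I = carrier R \<or> I = {\<zero>\<^bsub>R\<^esub>}"
  proof (cases "H = {}")
    case True
    then show ?thesis using H R.family_sum_empty by metis
  next
    case False
    then obtain h where h: "h \<in> H" by blast
    then have hG: "h \<in> carrier G" using H by blast
    have AI: "A h \<subseteq> I"
      unfolding H(2) using R.family_sum_component[where B=A, OF h] hG by auto
    have "\<one>\<^bsub>R\<^esub> \<in> sum_prod R (A h) (A (inv\<^bsub>G\<^esub> h))"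
      using s hG one_in_neutral_component unfolding strongly_graded_def by auto
    moreover have "A h \<subseteq> carrier R" "A (inv\<^bsub>G\<^esub> h) \<subseteq> carrier R"
      using hG component_carrier by auto
    ultimately have "\<one>\<^bsub>R\<^esub> \<in> I"
    proof (induction rule: R.sum_prod_induct)
      case (add t u v)
      then have "u \<otimes>\<^bsub>R\<^esub> v \<in> I"
        using AI hG by (intro I.I_r_closed) auto
      then show ?case using add by simp
    qed simp
    then show ?thesis using I.one_imp_carrier by blast
  qed
qed

text \<open>The set \<open>H\<close> in the proof consists of the degrees occurring in the ideal generated by \<open>R\<^sub>g\<close>. That
  it absorbs degrees from both sides is a matter of rebracketing \<open>c(agb)\<close> and \<open>(agb)c\<close>.\<close>

lemma graded_simple_imp_nonvanishing_inv:
  assumes gs: "graded_simple G R A" and g: "g \<in> carrier G"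
  shows "nonvanishing g (inv\<^bsub>G\<^esub> g)"
proof -
  define H where "H = {a \<otimes>\<^bsub>G\<^esub> g \<otimes>\<^bsub>G\<^esub> b | a b. a \<in> carrier G \<and> b \<in> carrier G \<and>
    nonvanishing a g \<and> nonvanishing (a \<otimes>\<^bsub>G\<^esub> g) b}"
  have H: "H \<subseteq> carrier G" unfolding H_def using g by auto
  have "ideal (family_sum R H A) R"
  proof (rule family_sum_ideal[OF H])
    fix c h assume c: "c \<in> carrier G" and "h \<in> H" and ch: "nonvanishing c h"
    then obtain a b where ab: "a \<in> carrier G" "b \<in> carrier G"
      and h: "h = a \<otimes>\<^bsub>G\<^esub> g \<otimes>\<^bsub>G\<^esub> b" and n: "nonvanishing a g" "nonvanishing (a \<otimes>\<^bsub>G\<^esub> g) b"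
      unfolding H_def by blast
    have "nonvanishing c (a \<otimes>\<^bsub>G\<^esub> g)" "nonvanishing (c \<otimes>\<^bsub>G\<^esub> (a \<otimes>\<^bsub>G\<^esub> g)) b"
      using nonvanishing_assoc_left[of c "a \<otimes>\<^bsub>G\<^esub> g" b] c ab g n ch h by auto
    moreover from this have "nonvanishing (c \<otimes>\<^bsub>G\<^esub> a) g"
      using nonvanishing_assoc_left[of c a g] c ab g n by auto
    ultimately have "c \<otimes>\<^bsub>G\<^esub> a \<in> carrier G" "nonvanishing (c \<otimes>\<^bsub>G\<^esub> a) g"
      "nonvanishing (c \<otimes>\<^bsub>G\<^esub> a \<otimes>\<^bsub>G\<^esub> g) b" "c \<otimes>\<^bsub>G\<^esub> h = c \<otimes>\<^bsub>G\<^esub> a \<otimes>\<^bsub>G\<^esub> g \<otimes>\<^bsub>G\<^esub> b"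
      using c ab g h by (auto simp: G.m_assoc)
    then show "c \<otimes>\<^bsub>G\<^esub> h \<in> H"
      unfolding H_def using ab by blast
  next
    fix c h assume c: "c \<in> carrier G" and "h \<in> H" and hc: "nonvanishing h c"
    then obtain a b where ab: "a \<in> carrier G" "b \<in> carrier G"
      and h: "h = a \<otimes>\<^bsub>G\<^esub> g \<otimes>\<^bsub>G\<^esub> b" and n: "nonvanishing a g" "nonvanishing (a \<otimes>\<^bsub>G\<^esub> g) b"
      unfolding H_def by blast
    have "nonvanishing (a \<otimes>\<^bsub>G\<^esub> g) (b \<otimes>\<^bsub>G\<^esub> c)"
      using nonvanishing_assoc_right[of "a \<otimes>\<^bsub>G\<^esub> g" b c] c ab g n hc h by auto
    moreover have "b \<otimes>\<^bsub>G\<^esub> c \<in> carrier G" "h \<otimes>\<^bsub>G\<^esub> c = a \<otimes>\<^bsub>G\<^esub> g \<otimes>\<^bsub>G\<^esub> (b \<otimes>\<^bsub>G\<^esub> c)"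
      using c ab g h by (auto simp: G.m_assoc)
    ultimately show "h \<otimes>\<^bsub>G\<^esub> c \<in> H"
      unfolding H_def using ab n by blast
  qed
  then have cases: "family_sum R H A = carrier R \<or> family_sum R H A = {\<zero>\<^bsub>R\<^esub>}"
    using gs ideal_graded unfolding graded_simple_def by blast
  have "g \<in> H"
    unfolding H_def using g nonvanishing_one[OF g]
    by (intro CollectI exI[of _ "\<one>\<^bsub>G\<^esub>"]) auto
  obtain x where x: "x \<in> A g" "x \<noteq> \<zero>\<^bsub>R\<^esub>"
    using component_nonzero[OF g] by blast
  have "x \<in> family_sum R H A"
    using R.family_sum_component[where B=A, OF \<open>g \<in> H\<close>] x g by simp
  then have all: "family_sum R H A = carrier R"
    using cases x by blast
  have "\<one>\<^bsub>G\<^esub> \<in> H"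
  proof (rule ccontr)
    assume e: "\<one>\<^bsub>G\<^esub> \<notin> H"
    obtain y where y: "y \<in> A \<one>\<^bsub>G\<^esub>" "y \<noteq> \<zero>\<^bsub>R\<^esub>"
      using component_nonzero[OF G.one_closed] by blast
    then show False
      using component_Int_family_sum[OF G.one_closed H e] all by simp
  qed
  then obtain a b where ab: "a \<in> carrier G" "b \<in> carrier G" "\<one>\<^bsub>G\<^esub> = a \<otimes>\<^bsub>G\<^esub> g \<otimes>\<^bsub>G\<^esub> b"
    and n: "nonvanishing a g" "nonvanishing (a \<otimes>\<^bsub>G\<^esub> g) b"
    unfolding H_def by blast
  \<comment> \<open>From \<open>agb = e\<close>: \<open>R\<^sub>g R\<^sub>b R\<^sub>a = R\<^bsub>a\<^sup>-\<^sup>1\<^esub> R\<^sub>a \<noteq> 0\<close>, and \<open>R\<^sub>b R\<^sub>a\<close> has degree \<open>g\<^sup>-\<^sup>1\<close>.\<close>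
  have "a \<otimes>\<^bsub>G\<^esub> (g \<otimes>\<^bsub>G\<^esub> b) = \<one>\<^bsub>G\<^esub>"
    using ab g by (simp add: G.m_assoc)
  then have gb: "g \<otimes>\<^bsub>G\<^esub> b = inv\<^bsub>G\<^esub> a"
    using ab g G.inv_equality G.inv_comm G.m_closed by metis
  have "(b \<otimes>\<^bsub>G\<^esub> a) \<otimes>\<^bsub>G\<^esub> g = \<one>\<^bsub>G\<^esub>"
    using ab g by (metis G.inv_comm G.m_assoc G.m_closed)
  then have ba: "b \<otimes>\<^bsub>G\<^esub> a = inv\<^bsub>G\<^esub> g"
    using ab g G.inv_equality G.m_closed by metis
  have gb_n: "nonvanishing g b" and "nonvanishing a (inv\<^bsub>G\<^esub> a)"
    using nonvanishing_assoc_right[OF ab(1) g ab(2) n] gb by auto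
  then have "nonvanishing (g \<otimes>\<^bsub>G\<^esub> b) a"
    using nonvanishing_inv_flip ab gb by simp
  then show ?thesis
    using nonvanishing_assoc_right[OF g ab(2,1) gb_n] ba by simp
qed

end

section \<open>Equivalence of the simplicity conditions\<close>

theorem proposition4p2:
  fixes G :: "('g, 'c) monoid_scheme" and R :: "('r, 'd) ring_scheme"
    and A :: "'g \<Rightarrow> 'r set"
  assumes "graded_ring G R A"
    and "controlled G R A"
  shows "(graded_simple G R A \<longleftrightarrow> simple_ring R) \<and>
    (simple_ring R \<longleftrightarrow> strongly_graded G R A) \<and>
    (strongly_graded G R A \<longleftrightarrow> left_nondegenerate G R A \<and> right_nondegenerate G R A)"
proof -
  interpret graded_ring G R A by fact
  interpret controlled_graded_ring G R A
    by unfold_locales (fact assms(2))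
  have "simple_ring R \<Longrightarrow> graded_simple G R A"
    unfolding simple_ring_def graded_simple_def graded_ideal_def by blast
  moreover have "graded_simple G R A \<Longrightarrow> strongly_graded G R A"
    using graded_simple_imp_nonvanishing_inv strongly_graded_iff_nonvanishing_inv by blast
  moreover have "right_nondegenerate G R A \<Longrightarrow> strongly_graded G R A"
    using right_nondegenerate_imp_nonvanishing_inv strongly_graded_iff_nonvanishing_inv by blast
  ultimately show ?thesis
    using strongly_graded_imp_simple strongly_graded_imp_nondegenerate by blast
qed

end
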